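(* Let $\phi$ be an eigenfunction of $L$ associated to the eigenvalue $\lambda$. Then $\phi$ is a solution on $[a,b]$ of the stochastic differential equation $$d\phi'(t)=\left[-2\lambda\phi(t)+\tfrac12\phi'(t)\right]dt+\phi'(t)\,dW(t),$$ with conditions $\phi(a)=0$ and $\phi(b)=0$.
   Context: $a<b$ are fixed and $W=\{W(x):x\in\mathbb{R}\}$ is a two-sided Brownian motion (the environment). For each realization of $W$, $L$ is the operator $Lf(x)=\frac{e^{W(x)}}{2}\left(e^{-W(x)}f'(x)\right)'$ with domain the differentiable functions $f$ on $[a,b]$ such that $f(a)=f(b)=0$ and $f'=e^{W}g$ with $g\in C^1$. An eigenpair $(\lambda,\phi)$, $\phi\neq 0$, satisfies $L\phi+\lambda\phi=0$ with $\phi(a)=\phi(b)=0$; both $\lambda$ and $\phi$ depend on $W$. The stochastic differential equation is understood in integral form, $\phi'(t)-\phi'(a)=\int_a^t\left[-2\lambda\phi(r)+\frac12\phi'(r)\right]dr+\int_a^t\phi'(r)\,dW(r)$, where the stochastic integral is the Itô-type (forward) integral, i.e. the limit in probability of left-endpoint Riemann sums $\sum_i\phi'(t_i)\,(W(t_{i+1})-W(t_i))$ over partitions of $[a,t]$ with mesh tending to $0$. *)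

theory Defs
  imports "HOL-Probability.Probability"
begin

locale two_sided_brownian_motion = prob_space M for M :: "'w measure" +
  fixes W :: "real \<Rightarrow> 'w \<Rightarrow> real"
  assumes rv: "\<And>x. random_variable borel (W x)"
    and start: "AE \<omega> in M. W 0 \<omega> = 0"
    and gaussian_increments: "\<And>s t. s < t \<Longrightarrow>
          distributed M lborel (\<lambda>\<omega>. W t \<omega> - W s \<omega>) (normal_density 0 (sqrt (t - s)))"
    and indep_increments: "\<And>n (t :: nat \<Rightarrow> real). (\<And>i. i < n \<Longrightarrow> t i < t (Suc i)) \<Longrightarrow>
          indep_vars (\<lambda>_. borel) (\<lambda>i \<omega>. W (t (Suc i)) \<omega> - W (t i) \<omega>) {..<n}"
    and continuous_paths: "AE \<omega> in M. continuous_on UNIV (\<lambda>x. W x \<omega>)"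

text \<open>Derivatives of functions on the interval from \<open>a\<close> to \<open>b\<close> are relative to that
  interval, hence one-sided at the end points; values outside the interval play no role.\<close>

definition ivl_deriv :: "real \<Rightarrow> real \<Rightarrow> (real \<Rightarrow> real) \<Rightarrow> real \<Rightarrow> real" where
  "ivl_deriv a b f x = vector_derivative f (at x within {a..b})"

definition C1_ivl :: "real \<Rightarrow> real \<Rightarrow> (real \<Rightarrow> real) \<Rightarrow> bool" where
  "C1_ivl a b g \<longleftrightarrow> g differentiable_on {a..b} \<and> continuous_on {a..b} (ivl_deriv a b g)"

definition L_op :: "real \<Rightarrow> real \<Rightarrow> (real \<Rightarrow> real) \<Rightarrow> (real \<Rightarrow> real) \<Rightarrow> real \<Rightarrow> real" where
  "L_op a b w f x = exp (w x) / 2 * ivl_deriv a b (\<lambda>y. exp (- w y) * ivl_deriv a b f y) x"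

definition L_dom :: "real \<Rightarrow> real \<Rightarrow> (real \<Rightarrow> real) \<Rightarrow> (real \<Rightarrow> real) set" where
  "L_dom a b w = {f. f differentiable_on {a..b} \<and> f a = 0 \<and> f b = 0 \<and>
     (\<exists>g. C1_ivl a b g \<and> (\<forall>x\<in>{a..b}. ivl_deriv a b f x = exp (w x) * g x))}"

definition eigenpair :: "real \<Rightarrow> real \<Rightarrow> (real \<Rightarrow> real) \<Rightarrow> real \<Rightarrow> (real \<Rightarrow> real) \<Rightarrow> bool" where
  "eigenpair a b w lam f \<longleftrightarrow> f \<in> L_dom a b w \<and> (\<exists>x\<in>{a..b}. f x \<noteq> 0) \<and>
     (\<forall>x\<in>{a..b}. L_op a b w f x + lam * f x = 0)"

text \<open>Convergence in probability along a filter. The exceptional events are required to be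
  contained in small measurable ones, so the notion is meaningful also for maps that are
  measurable only up to a null set; for random variables it is the usual one, see
  \<open>conv_in_prob_iff_tendsto\<close> below.\<close>

definition conv_in_prob ::
    "'w measure \<Rightarrow> ('i \<Rightarrow> 'w \<Rightarrow> real) \<Rightarrow> ('w \<Rightarrow> real) \<Rightarrow> 'i filter \<Rightarrow> bool" where
  "conv_in_prob M S I F \<longleftrightarrow> (\<forall>\<epsilon>>0. \<forall>\<delta>>0. \<forall>\<^sub>F i in F.
     \<exists>N\<in>sets M. {\<omega> \<in> space M. \<bar>S i \<omega> - I \<omega>\<bar> > \<epsilon>} \<subseteq> N \<and> measure M N < \<delta>)"

lemma conv_in_prob_iff_tendsto:
  assumes "prob_space M" "\<And>i. S i \<in> borel_measurable M" "I \<in> borel_measurable M"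
  shows "conv_in_prob M S I F \<longleftrightarrow>
    (\<forall>\<epsilon>>0. ((\<lambda>i. measure M {\<omega> \<in> space M. \<bar>S i \<omega> - I \<omega>\<bar> > \<epsilon>}) \<longlongrightarrow> 0) F)"
proof -
  interpret prob_space M by fact
  have m: "{\<omega> \<in> space M. \<bar>S i \<omega> - I \<omega>\<bar> > \<epsilon>} \<in> sets M" for i \<epsilon>
    using assms(2)[of i] assms(3) by measurable
  have "(\<exists>N\<in>sets M. {\<omega> \<in> space M. \<bar>S i \<omega> - I \<omega>\<bar> > \<epsilon>} \<subseteq> N \<and> measure M N < \<delta>) \<longleftrightarrow>
      measure M {\<omega> \<in> space M. \<bar>S i \<omega> - I \<omega>\<bar> > \<epsilon>} < \<delta>" for i \<epsilon> \<delta>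
    using m[of \<epsilon> i] finite_measure_mono by (meson order.strict_trans1 subset_refl)
  then show ?thesis
    by (simp add: conv_in_prob_def tendsto_iff)
qed

text \<open>A partition of the interval from \<open>a\<close> to \<open>t\<close> is a pair \<open>(n, p)\<close>
  representing \<open>a = p 0 < \<dots> < p n = t\<close>; for \<open>t = a\<close> only \<open>n = 0\<close> is possible.\<close>

definition is_partition :: "real \<Rightarrow> real \<Rightarrow> nat \<times> (nat \<Rightarrow> real) \<Rightarrow> bool" where
  "is_partition a t = (\<lambda>(n, p). p 0 = a \<and> p n = t \<and> (\<forall>i<n. p i < p (Suc i)))"

definition mesh_less :: "real \<Rightarrow> nat \<times> (nat \<Rightarrow> real) \<Rightarrow> bool" where
  "mesh_less \<eta> = (\<lambda>(n, p). \<forall>i<n. p (Suc i) - p i < \<eta>)"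

definition partition_filter :: "real \<Rightarrow> real \<Rightarrow> (nat \<times> (nat \<Rightarrow> real)) filter" where
  "partition_filter a t = (INF \<eta>\<in>{0<..}. principal {P. is_partition a t P \<and> mesh_less \<eta> P})"

lemma eventually_partition_filter:
  "eventually Q (partition_filter a t) \<longleftrightarrow>
     (\<exists>\<eta>>0. \<forall>P. is_partition a t P \<longrightarrow> mesh_less \<eta> P \<longrightarrow> Q P)"
proof -
  have "\<exists>x\<in>{0<..}. principal {P. is_partition a t P \<and> mesh_less x P}
      \<le> inf (principal {P. is_partition a t P \<and> mesh_less c P})
            (principal {P. is_partition a t P \<and> mesh_less d P})"
    if "c > 0" "d > 0" for c d
    using that by (intro bexI[of _ "min c d"]) (auto simp: mesh_less_def)
  then show ?thesis
    unfolding partition_filter_def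
    by (subst eventually_INF_base) (auto simp: eventually_principal Bex_def)
qed

lemma partition_filter_neq_bot:
  assumes "a \<le> t"
  shows "partition_filter a t \<noteq> bot"
proof -
  have "\<exists>P. is_partition a t P \<and> mesh_less \<eta> P" if "\<eta> > 0" for \<eta>
  proof (cases "a = t")
    case True
    then show ?thesis
      by (intro exI[of _ "(0, \<lambda>_. a)"]) (auto simp: is_partition_def mesh_less_def)
  next
    case False
    with assms have at: "a < t" by simp
    obtain n :: nat where n: "(t - a) / \<eta> < real n"
      using reals_Archimedean2 by blast
    have n0: "real n > 0"
      using n at \<open>\<eta> > 0\<close> by (meson diff_gt_0_iff_gt divide_pos_pos order.strict_trans)
    define p where "p i = a + real i * ((t - a) / real n)" for i :: nat
    have step: "p (Suc i) - p i = (t - a) / real n" for i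
      by (simp add: p_def algebra_simps add_divide_distrib diff_divide_distrib)
    have "(t - a) / real n < \<eta>"
      using n n0 \<open>\<eta> > 0\<close> by (simp add: field_simps)
    moreover have "(t - a) / real n > 0"
      using at n0 by simp
    moreover have "p 0 = a" "p n = t"
      using n0 by (simp_all add: p_def)
    ultimately have "is_partition a t (n, p) \<and> mesh_less \<eta> (n, p)"
      unfolding is_partition_def mesh_less_def prod.case using step by (metis diff_gt_0_iff_gt)
    then show ?thesis by blast
  qed
  then show ?thesis
    unfolding trivial_limit_def eventually_partition_filter by blast
qed

definition forward_sum ::
    "(real \<Rightarrow> 'w \<Rightarrow> real) \<Rightarrow> (real \<Rightarrow> 'w \<Rightarrow> real) \<Rightarrow> nat \<times> (nat \<Rightarrow> real) \<Rightarrow> 'w \<Rightarrow> real" where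
  "forward_sum X W = (\<lambda>(n, p) \<omega>. \<Sum>i<n. X (p i) \<omega> * (W (p (Suc i)) \<omega> - W (p i) \<omega>))"

text \<open>\<open>I\<close> is a version of the integral of \<open>X\<close> with respect to \<open>W\<close> from \<open>a\<close> to \<open>t\<close>; no
  adaptedness of \<open>X\<close> is required.\<close>

definition has_forward_integral ::
    "'w measure \<Rightarrow> (real \<Rightarrow> 'w \<Rightarrow> real) \<Rightarrow> (real \<Rightarrow> 'w \<Rightarrow> real) \<Rightarrow> real \<Rightarrow> real \<Rightarrow> ('w \<Rightarrow> real) \<Rightarrow> bool"
  where
  "has_forward_integral M W X a t I \<longleftrightarrow>
     I \<in> borel_measurable M \<and> conv_in_prob M (forward_sum X W) I (partition_filter a t)"

definition path_deriv ::
    "real \<Rightarrow> real \<Rightarrow> (real \<Rightarrow> 'w \<Rightarrow> real) \<Rightarrow> real \<Rightarrow> 'w \<Rightarrow> real" where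
  "path_deriv a b X t \<omega> = ivl_deriv a b (\<lambda>x. X x \<omega>) t"

text \<open>\<open>X\<close> solves \<open>dX' = [-2 lam X + X'/2] dt + X' dW\<close> on the interval from \<open>a\<close> to \<open>b\<close>, in
  integral form.\<close>

definition solves_sde ::
    "'w measure \<Rightarrow> (real \<Rightarrow> 'w \<Rightarrow> real) \<Rightarrow> real \<Rightarrow> real \<Rightarrow> ('w \<Rightarrow> real) \<Rightarrow> (real \<Rightarrow> 'w \<Rightarrow> real) \<Rightarrow> bool"
  where
  "solves_sde M W a b lam X \<longleftrightarrow>
     (AE \<omega> in M. (\<lambda>t. X t \<omega>) differentiable_on {a..b}) \<and>
     (\<exists>I. (\<forall>t\<in>{a..b}. has_forward_integral M W (path_deriv a b X) a t (I t)) \<and>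
       (AE \<omega> in M. \<forall>t\<in>{a..b}.
          set_integrable lborel {a..t}
            (\<lambda>r. - 2 * lam \<omega> * X r \<omega> + 1/2 * path_deriv a b X r \<omega>) \<and>
          path_deriv a b X t \<omega> - path_deriv a b X a \<omega> =
            (LINT r:{a..t}|lborel. - 2 * lam \<omega> * X r \<omega> + 1/2 * path_deriv a b X r \<omega>) + I t \<omega>))"

end

theory Submission
  imports Defs
begin

text \<open>
  Write \<open>\<phi>' = e\<^sup>W h\<close>. The eigenvalue equation says precisely that \<open>h\<close> is continuously
  differentiable with \<open>h' = -2 \<lambda> e\<^sup>-\<^sup>W \<phi>\<close>. So the only rough factor of \<open>\<phi>'\<close> is \<open>e\<^sup>W\<close>, and the
  equation is the Ito formula for \<open>e\<^sup>W h\<close>: over a short interval from \<open>s\<close> to \<open>u\<close>,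
  with \<open>\<Delta>W = W(u) - W(s)\<close>,
  \<open>\<phi>'(u) - \<phi>'(s) = \<phi>'(s) \<Delta>W + \<phi>'(s) (\<Delta>W)\<^sup>2 / 2 + e\<^sup>W h' (u - s)\<close> up to negligible terms,
  where \<open>e\<^sup>W h' = -2 \<lambda> \<phi>\<close> and \<open>(\<Delta>W)\<^sup>2\<close> may be replaced by \<open>u - s\<close>.

  The process \<open>\<phi>'\<close> depends on the whole environment and is not adapted, so the last
  replacement cannot use martingale arguments with \<open>\<phi>'\<close> as integrand. Instead, randomness and
  weights are separated. For deterministic weights, the sums of \<open>q(s) ((\<Delta>W)\<^sup>2 - (u - s))\<close>
  have second moment of the order of the mesh, because their summands are independent and
  centred (\<open>weighted_quadratic_variation_second_moment\<close>); hence they tend to \<open>0\<close> almost surely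
  along partitions whose mesh is below \<open>2\<^sup>-\<^sup>k\<close>, simultaneously for all monomials \<open>q\<close>
  (\<open>AE_monomial_quadratic_variation\<close>). On a path where this holds, the Weierstrass theorem extends
  it to every continuous weight, including the path of \<open>\<phi>'\<close> itself
  (\<open>weighted_quadratic_variation\<close>), and the expansion above becomes a statement about one path
  (\<open>pathwise_ito_exp_mult\<close>).

  Convergence in probability as the mesh shrinks follows from almost sure convergence
  along all such sequences: were it to fail, a sequence of partitions with meshes below
  \<open>2\<^sup>-\<^sup>k\<close> would witness the failure (\<open>conv_in_prob_partition_filterI\<close>).
\<close>

section \<open>Sums over partitions\<close>

definition partition_sum :: "(real \<Rightarrow> real \<Rightarrow> real) \<Rightarrow> nat \<times> (nat \<Rightarrow> real) \<Rightarrow> real" where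
  "partition_sum f = (\<lambda>(n, p). \<Sum>i<n. f (p i) (p (Suc i)))"

lemma partition_sum_add:
  "partition_sum (\<lambda>s u. f s u + g s u) P = partition_sum f P + partition_sum g P"
  by (cases P) (simp add: partition_sum_def sum.distrib)

lemma partition_sum_diff:
  "partition_sum (\<lambda>s u. f s u - g s u) P = partition_sum f P - partition_sum g P"
  by (cases P) (simp add: partition_sum_def sum_subtractf)

lemma partition_sum_cmult:
  "partition_sum (\<lambda>s u. c * f s u) P = c * partition_sum f P"
  by (cases P) (simp add: partition_sum_def sum_distrib_left)

lemma partition_sum_sum:
  "partition_sum (\<lambda>s u. \<Sum>m\<in>A. f m s u) P = (\<Sum>m\<in>A. partition_sum (f m) P)"
proof (cases P)
  case (Pair n p)
  then show ?thesis by (simp add: partition_sum_def) (rule sum.swap)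
qed

lemma partition_sum_telescope:
  assumes "is_partition a t P"
  shows "partition_sum (\<lambda>s u. F u - F s) P = F t - F a"
proof (cases P)
  case (Pair n p)
  have "(\<Sum>i<n. F (p (Suc i)) - F (p i)) = F (p n) - F (p 0)"
    by (rule sum_lessThan_telescope)
  then show ?thesis
    using assms Pair by (simp add: partition_sum_def is_partition_def)
qed

lemma is_partition_mono:
  assumes "is_partition a t (n, p)" "i \<le> j" "j \<le> n"
  shows "p i \<le> p j"
  using assms(2,3)
proof (induction j rule: dec_induct)
  case base
  show ?case by simp
next
  case (step m)
  have "p m < p (Suc m)"
    using assms(1) step.prems by (auto simp: is_partition_def)
  with step show ?case by simp
qed

lemma is_partition_bounds:
  assumes "is_partition a t (n, p)" "i \<le> n"
  shows "a \<le> p i" "p i \<le> t"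
  using is_partition_mono[OF assms(1), of 0 i] is_partition_mono[OF assms(1), of i n] assms
  by (auto simp: is_partition_def)

lemma partition_sum_abs_le:
  assumes "is_partition a t P" "mesh_less \<eta> P"
    and "\<And>s u. a \<le> s \<Longrightarrow> s < u \<Longrightarrow> u \<le> t \<Longrightarrow> u - s < \<eta> \<Longrightarrow> \<bar>f s u\<bar> \<le> g s u"
  shows "\<bar>partition_sum f P\<bar> \<le> partition_sum g P"
proof (cases P)
  case (Pair n p)
  have "\<bar>f (p i) (p (Suc i))\<bar> \<le> g (p i) (p (Suc i))" if "i < n" for i
  proof (rule assms(3))
    show "a \<le> p i" "p (Suc i) \<le> t"
      using is_partition_bounds[of a t n p] assms(1) that Pair by auto
  qed (use assms(1,2) that Pair in \<open>auto simp: is_partition_def mesh_less_def\<close>)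
  then show ?thesis
    unfolding Pair partition_sum_def prod.case
    by (intro order_trans[OF sum_abs] sum_mono) auto
qed

lemma eventually_partition:
  assumes "\<eta> > 0"
  shows "eventually (\<lambda>P. is_partition a t P \<and> mesh_less \<eta> P) (partition_filter a t)"
  unfolding eventually_partition_filter using assms by blast

text \<open>The criterion by which every error term is discarded: a contribution that is, uniformly on
  short intervals, small compared with one whose sums stay bounded. It is used with \<open>g\<close> the
  length of the interval and with \<open>g\<close> the squared increment of the path. The filter is kept
  general because squared Brownian increments have bounded sums only along suitable sequences
  of partitions.\<close>

lemma partition_sum_negligible:
  assumes F: "F \<le> partition_filter a t"
    and bounded: "eventually (\<lambda>P. partition_sum g P \<le> B) F"
    and small: "\<And>\<epsilon>. \<epsilon> > 0 \<Longrightarrow> \<exists>\<eta>>0. \<forall>s u. a \<le> s \<longrightarrow> s < u \<longrightarrow> u \<le> t \<longrightarrow> u - s < \<eta> \<longrightarrow>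
      \<bar>f s u\<bar> \<le> \<epsilon> * g s u"
  shows "(partition_sum f \<longlongrightarrow> 0) F"
proof (rule tendstoI)
  fix e :: real assume "e > 0"
  define \<epsilon> where "\<epsilon> = e / (\<bar>B\<bar> + 1)"
  have "\<epsilon> > 0" using \<open>e > 0\<close> by (simp add: \<epsilon>_def)
  from small[OF this] obtain \<eta> where "\<eta> > 0" and
    \<eta>: "\<And>s u. a \<le> s \<Longrightarrow> s < u \<Longrightarrow> u \<le> t \<Longrightarrow> u - s < \<eta> \<Longrightarrow> \<bar>f s u\<bar> \<le> \<epsilon> * g s u"
    by blast
  have "eventually (\<lambda>P. is_partition a t P \<and> mesh_less \<eta> P) F"
    using eventually_partition[OF \<open>\<eta> > 0\<close>] F by (rule filter_leD[rotated])
  with bounded show "eventually (\<lambda>P. dist (partition_sum f P) 0 < e) F"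
  proof eventually_elim
    case (elim P)
    have "\<bar>partition_sum f P\<bar> \<le> partition_sum (\<lambda>s u. \<epsilon> * g s u) P"
      using elim \<eta> by (intro partition_sum_abs_le) auto
    also have "\<dots> = \<epsilon> * partition_sum g P"
      by (rule partition_sum_cmult)
    also have "\<dots> \<le> \<epsilon> * \<bar>B\<bar>"
      using elim \<open>\<epsilon> > 0\<close> by (intro mult_left_mono) auto
    also have "\<dots> < e"
      using \<open>e > 0\<close> by (simp add: \<epsilon>_def field_simps)
    finally show ?case by simp
  qed
qed

lemma ex_partition_sequence:
  assumes "a \<le> t"
  obtains P where "\<And>k::nat. is_partition a t (P k)" "\<And>k. mesh_less (1/2^k) (P k)"
proof -
  have "\<exists>P. is_partition a t P \<and> mesh_less (1/2^k) P" for k :: nat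
    using partition_filter_neq_bot[OF assms] eventually_partition[of "1/2^k" a t]
      eventually_happens' by fastforce
  then show thesis using that by metis
qed

lemma filterlim_partition_sequence:
  assumes "\<And>k::nat. is_partition a t (P k)" "\<And>k. mesh_less (1/2^k) (P k)"
  shows "filterlim P (partition_filter a t) sequentially"
proof -
  have "\<forall>\<^sub>F k in sequentially. is_partition a t (P k) \<and> mesh_less \<eta> (P k)" if "\<eta> > 0" for \<eta>
  proof -
    have "(\<lambda>k::nat. (1/2::real)^k) \<longlonglongrightarrow> 0"
      by (intro LIMSEQ_realpow_zero) auto
    then have "\<forall>\<^sub>F k in sequentially. (1/2::real)^k < \<eta>"
      using that by (rule order_tendstoD)
    then show ?thesis
    proof eventually_elim
      case (elim k)
      then show ?case
        using assms(1)[of k] assms(2)[of k]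
        by (auto simp: mesh_less_def power_one_over split: prod.splits)
    qed
  qed
  then show ?thesis
    unfolding partition_filter_def filterlim_INF filterlim_principal by auto
qed

lemma uniform_modulus_on_interval:
  fixes f :: "real \<Rightarrow> real"
  assumes "continuous_on {a..t} f" "\<epsilon> > 0"
  obtains \<eta> where "\<eta> > 0"
    "\<And>x y. x \<in> {a..t} \<Longrightarrow> y \<in> {a..t} \<Longrightarrow> \<bar>x - y\<bar> < \<eta> \<Longrightarrow> \<bar>f x - f y\<bar> < \<epsilon>"
proof -
  obtain \<eta> where "\<eta> > 0" and
    \<eta>: "\<forall>y\<in>{a..t}. \<forall>x\<in>{a..t}. \<bar>x - y\<bar> < \<eta> \<longrightarrow> \<bar>f x - f y\<bar> < \<epsilon>"
    using compact_uniformly_continuous[OF assms(1) compact_Icc] assms(2)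
    unfolding uniformly_continuous_on_def dist_real_def by (elim allE impE exE conjE) assumption+
  show thesis
    by (rule that[of \<eta>]) (use \<open>\<eta> > 0\<close> \<eta> in blast)+
qed

text \<open>On each interval the function \<open>x \<mapsto> c s * x - V x\<close> has derivative \<open>c s - c x\<close>, which is
  uniformly small, so by the mean value inequality its increment is negligible against the
  length. These sums serve to show that the drift integral is a random variable.\<close>

lemma riemann_sums_tendsto:
  assumes c: "continuous_on {a..t} c"
    and V: "\<And>x. x \<in> {a..t} \<Longrightarrow> (V has_real_derivative c x) (at x within {a..t})"
  shows "(partition_sum (\<lambda>s u. c s * (u - s)) \<longlongrightarrow> V t - V a) (partition_filter a t)"
proof -
  let ?F = "partition_filter a t"
  have part: "eventually (is_partition a t) ?F"
    using eventually_partition[of 1 a t] by (auto elim: eventually_mono)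
  have "(partition_sum (\<lambda>s u. c s * (u - s) - (V u - V s)) \<longlongrightarrow> 0) ?F"
  proof (rule partition_sum_negligible[where g = "\<lambda>s u. u - s" and B = "t - a"])
    show "eventually (\<lambda>P. partition_sum (\<lambda>s u. u - s) P \<le> t - a) ?F"
      using part by eventually_elim (simp add: partition_sum_telescope[where F = "\<lambda>x. x"])
    fix \<epsilon> :: real assume "\<epsilon> > 0"
    obtain \<eta> where "\<eta> > 0" and
      \<eta>: "\<And>x y. x \<in> {a..t} \<Longrightarrow> y \<in> {a..t} \<Longrightarrow> \<bar>x - y\<bar> < \<eta> \<Longrightarrow> \<bar>c x - c y\<bar> < \<epsilon>"
      by (rule uniform_modulus_on_interval[OF c \<open>\<epsilon> > 0\<close>]) (rule that)
    have "\<bar>c s * (u - s) - (V u - V s)\<bar> \<le> \<epsilon> * (u - s)"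
      if "a \<le> s" "s < u" "u \<le> t" "u - s < \<eta>" for s u
    proof -
      have "norm ((c s * u - V u) - (c s * s - V s)) \<le> \<epsilon> * norm (u - s)"
      proof (rule field_differentiable_bound[where S = "{s..u}" and x = u and y = s
            and f = "\<lambda>x. c s * x - V x" and f' = "\<lambda>x. c s - c x"])
        fix x assume x: "x \<in> {s..u}"
        have "(V has_real_derivative c x) (at x within {s..u})"
          by (rule DERIV_subset[OF V]) (use x that in auto)
        then show "((\<lambda>x. c s * x - V x) has_real_derivative c s - c x) (at x within {s..u})"
          by (intro DERIV_diff DERIV_cmult_Id)
        have "\<bar>c s - c x\<bar> < \<epsilon>"
          using x that by (intro \<eta>) auto
        then show "norm (c s - c x) \<le> \<epsilon>" by simp
      qed (use that in auto)
      then show ?thesis using that by (simp add: algebra_simps)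
    qed
    then show "\<exists>\<eta>>0. \<forall>s u. a \<le> s \<longrightarrow> s < u \<longrightarrow> u \<le> t \<longrightarrow> u - s < \<eta> \<longrightarrow>
        \<bar>c s * (u - s) - (V u - V s)\<bar> \<le> \<epsilon> * (u - s)"
      using \<open>\<eta> > 0\<close> by blast
  qed simp
  moreover have "\<forall>\<^sub>F P in ?F. partition_sum (\<lambda>s u. c s * (u - s) - (V u - V s)) P =
      partition_sum (\<lambda>s u. c s * (u - s)) P - (V t - V a)"
    using part by eventually_elim (subst partition_sum_diff, simp add: partition_sum_telescope)
  ultimately have "((\<lambda>P. partition_sum (\<lambda>s u. c s * (u - s)) P - (V t - V a)) \<longlongrightarrow> 0) ?F"
    by (rule Lim_transform_eventually)
  then show ?thesis by (rule LIM_zero_cancel)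
qed

section \<open>Pathwise Ito expansion of a smooth multiple of an exponential\<close>

lemma exp_second_order_remainder:
  fixes x :: real
  assumes "\<bar>x\<bar> \<le> 1"
  shows "\<bar>exp x - 1 - x - x\<^sup>2 / 2\<bar> \<le> \<bar>x\<bar> * x\<^sup>2"
proof -
  obtain t where t: "\<bar>t\<bar> \<le> \<bar>x\<bar>" and
    e: "exp x = (\<Sum>m<3. x ^ m / fact m) + exp t / fact 3 * x ^ 3"
    using Maclaurin_exp_le[of x 3] by blast
  have "exp x - 1 - x - x\<^sup>2 / 2 = exp t / 6 * x ^ 3"
    using e by (simp add: eval_nat_numeral)
  moreover have "exp t \<le> 3"
    using t assms exp_le by (intro order_trans[of "exp t" "exp 1" 3]) auto
  ultimately have "\<bar>exp x - 1 - x - x\<^sup>2 / 2\<bar> \<le> 1 * \<bar>x\<bar> ^ 3"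
    by (simp only: abs_mult power_abs) (intro mult_right_mono, auto)
  then show ?thesis by (simp add: power3_eq_cube power2_eq_square)
qed

text \<open>A polynomial uniformly close to \<open>G\<close> changes the sum by at most the distance times
  the sum of the \<open>\<bar>(w u - w s)\<^sup>2 - (u - s)\<bar>\<close>, which is bounded because the case \<open>m = 0\<close> of the
  hypothesis bounds the sums of squared increments.\<close>

lemma weighted_quadratic_variation:
  fixes w G :: "real \<Rightarrow> real"
  assumes F: "F \<le> partition_filter a t"
    and qv: "\<And>m. (partition_sum (\<lambda>s u. s ^ m * ((w u - w s)\<^sup>2 - (u - s))) \<longlongrightarrow> 0) F"
    and G: "continuous_on {a..t} G"
  shows "(partition_sum (\<lambda>s u. G s * ((w u - w s)\<^sup>2 - (u - s))) \<longlongrightarrow> 0) F"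
proof (rule tendstoI)
  let ?d = "\<lambda>s u. (w u - w s)\<^sup>2 - (u - s)"
  have part: "eventually (is_partition a t) F"
    using eventually_partition[of 1 a t] F by (auto elim: eventually_mono intro: filter_leD)
  fix e :: real assume "e > 0"
  define D where "D = 2 * \<bar>t - a\<bar> + 1"
  define \<epsilon> where "\<epsilon> = e / 2 / D"
  have "D > 0" unfolding D_def by (intro add_nonneg_pos) auto
  then have "\<epsilon> > 0" using \<open>e > 0\<close> by (simp add: \<epsilon>_def)
  have aux: "x + 2 * y \<le> 2 * \<bar>y\<bar> + 1" if "\<bar>x\<bar> < 1" for x y :: real
    using that by linarith
  obtain q where "real_polynomial_function q" and
    q: "\<And>x. x \<in> {a..t} \<Longrightarrow> \<bar>G x - q x\<bar> < \<epsilon>"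
    by (rule Stone_Weierstrass_real_polynomial_function[OF compact_Icc G \<open>\<epsilon> > 0\<close>]) (rule that)
  then obtain c and n :: nat where q_eq: "q = (\<lambda>x. \<Sum>m\<le>n. c m * x ^ m)"
    unfolding real_polynomial_function_iff_sum by blast
  have "((\<lambda>P. \<Sum>m\<le>n. c m * partition_sum (\<lambda>s u. s ^ m * ?d s u) P) \<longlongrightarrow> (\<Sum>m\<le>n. c m * 0)) F"
    by (intro tendsto_sum tendsto_mult tendsto_const qv)
  moreover have "partition_sum (\<lambda>s u. q s * ?d s u) P =
      (\<Sum>m\<le>n. c m * partition_sum (\<lambda>s u. s ^ m * ?d s u) P)" for P
    unfolding q_eq
    by (simp only: partition_sum_sum[symmetric] partition_sum_cmult[symmetric] sum_distrib_right mult.assoc)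
  ultimately have "((\<lambda>P. partition_sum (\<lambda>s u. q s * ?d s u) P) \<longlongrightarrow> 0) F"
    by simp
  then have poly: "\<forall>\<^sub>F P in F. \<bar>partition_sum (\<lambda>s u. q s * ?d s u) P\<bar> < e / 2"
    using \<open>e > 0\<close> by (auto dest!: tendstoD[of _ 0 _ "e / 2"])
  have "\<forall>\<^sub>F P in F. \<bar>partition_sum ?d P\<bar> < 1"
    using tendstoD[OF qv[of 0], of 1] by simp
  with part poly show "\<forall>\<^sub>F P in F. dist (partition_sum (\<lambda>s u. G s * ?d s u) P) 0 < e"
  proof eventually_elim
    case (elim P)
    \<comment> \<open>The comparison is valid on intervals of any length, so any bound for the mesh will do.\<close>
    obtain \<eta> where mesh: "mesh_less \<eta> P"
    proof (cases P)
      case (Pair n p)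
      have "p (Suc i) - p i < t - a + 1" if "i < n" for i
        using is_partition_bounds[of a t n p "Suc i"] is_partition_bounds[of a t n p i] elim Pair that
        by auto
      then show thesis using that[of "t - a + 1"] Pair by (simp add: mesh_less_def)
    qed
    have "\<bar>partition_sum (\<lambda>s u. (G s - q s) * ?d s u) P\<bar>
        \<le> partition_sum (\<lambda>s u. \<epsilon> * (?d s u + 2 * (u - s))) P"
    proof (rule partition_sum_abs_le[OF elim(1) mesh])
      fix s u assume su: "a \<le> s" "s < u" "u \<le> t"
      \<comment> \<open>The right-hand side is \<open>(w u - w s)\<^sup>2 + (u - s)\<close>, written so that its sums are known.\<close>
      have "\<bar>?d s u\<bar> \<le> ?d s u + 2 * (u - s)"
        using su by (simp add: abs_le_iff)
      moreover have "\<bar>G s - q s\<bar> \<le> \<epsilon>" using q[of s] su by auto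
      ultimately show "\<bar>(G s - q s) * ?d s u\<bar> \<le> \<epsilon> * (?d s u + 2 * (u - s))"
        unfolding abs_mult using \<open>\<epsilon> > 0\<close> by (intro mult_mono) auto
    qed
    also have "\<dots> = \<epsilon> * (partition_sum ?d P + 2 * (t - a))"
      using partition_sum_telescope[OF elim(1), of "\<lambda>x. x"]
      unfolding partition_sum_cmult partition_sum_add by simp
    also have "\<dots> \<le> \<epsilon> * D"
    proof (intro mult_left_mono)
      show "partition_sum ?d P + 2 * (t - a) \<le> D" unfolding D_def
        by (rule aux[OF elim(3)])
    qed (use \<open>\<epsilon> > 0\<close> in simp)
    also have "\<dots> = e / 2" using \<open>D > 0\<close> by (simp add: \<epsilon>_def)
    finally have "\<bar>partition_sum (\<lambda>s u. (G s - q s) * ?d s u) P\<bar> \<le> e / 2" .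
    moreover have "partition_sum (\<lambda>s u. G s * ?d s u) P =
        partition_sum (\<lambda>s u. (G s - q s) * ?d s u) P + partition_sum (\<lambda>s u. q s * ?d s u) P"
      by (simp add: partition_sum_add[symmetric] algebra_simps)
    ultimately show ?case using elim(2) by simp
  qed
qed

text \<open>The Ito formula for \<open>e\<^sup>w h\<close> along a single path. The increment of \<open>G = e\<^sup>w h\<close> splits exactly
  into the forward term, the increment of \<open>V\<close>, and three errors: the third-order
  remainder \<open>A\<close> of the exponential, negligible against squared increments; the
  smooth part \<open>B\<close>, negligible against lengths; and the fluctuation of the quadratic variation
  weighted by \<open>G / 2\<close>.\<close>

lemma pathwise_ito_exp_mult:
  fixes w h h' V :: "real \<Rightarrow> real"
  assumes F: "F \<le> partition_filter a t"
    and w: "continuous_on {a..t} w"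
    and h: "\<And>x. x \<in> {a..t} \<Longrightarrow> (h has_real_derivative h' x) (at x within {a..t})"
    and h': "continuous_on {a..t} h'"
    and qv: "\<And>m. (partition_sum (\<lambda>s u. s ^ m * ((w u - w s)\<^sup>2 - (u - s))) \<longlongrightarrow> 0) F"
    and V: "\<And>x. x \<in> {a..t} \<Longrightarrow>
      (V has_real_derivative exp (w x) * h' x + 1/2 * (exp (w x) * h x)) (at x within {a..t})"
  shows "(partition_sum (\<lambda>s u. exp (w s) * h s * (w u - w s)) \<longlongrightarrow>
    exp (w t) * h t - exp (w a) * h a - (V t - V a)) F"
proof -
  define G where "G x = exp (w x) * h x" for x
  define A where "A s u = G s * (exp (w u - w s) - 1 - (w u - w s) - (w u - w s)\<^sup>2 / 2)" for s u
  define B where "B s u = exp (w u) * (h u - h s) + 1/2 * G s * (u - s) - (V u - V s)" for s u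
  have part: "eventually (is_partition a t) F"
    using eventually_partition[of 1 a t] F by (auto elim: eventually_mono intro: filter_leD)
  have hc: "continuous_on {a..t} h"
    using h by (intro DERIV_continuous_on)
  have G: "continuous_on {a..t} G"
    unfolding G_def by (intro continuous_intros w hc)
  have bound: "\<exists>K>0. \<forall>x\<in>{a..t}. \<bar>f x\<bar> \<le> K" if "continuous_on {a..t} f" for f :: "real \<Rightarrow> real"
  proof -
    have "bounded (f ` {a..t})"
      using that by (intro compact_imp_bounded compact_continuous_image) auto
    then show ?thesis unfolding bounded_pos by auto
  qed

  have A0: "(partition_sum A \<longlongrightarrow> 0) F"
  proof (rule partition_sum_negligible[OF F, where g = "\<lambda>s u. (w u - w s)\<^sup>2" and B = "t - a + 1"])
    have "\<forall>\<^sub>F P in F. \<bar>partition_sum (\<lambda>s u. (w u - w s)\<^sup>2 - (u - s)) P\<bar> < 1"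
      using tendstoD[OF qv[of 0], of 1] by simp
    with part show "\<forall>\<^sub>F P in F. partition_sum (\<lambda>s u. (w u - w s)\<^sup>2) P \<le> t - a + 1"
    proof eventually_elim
      case (elim P)
      have "partition_sum (\<lambda>s u. (w u - w s)\<^sup>2 - (u - s)) P =
          partition_sum (\<lambda>s u. (w u - w s)\<^sup>2) P - (t - a)"
        using partition_sum_telescope[OF elim(1), of "\<lambda>x. x"] by (subst partition_sum_diff) simp
      with elim(2) show ?case by (simp only: abs_less_iff) simp
    qed
    fix \<epsilon> :: real assume "\<epsilon> > 0"
    obtain K where K: "K > 0" "\<And>x. x \<in> {a..t} \<Longrightarrow> \<bar>G x\<bar> \<le> K"
      using bound[OF G] by blast
    obtain \<eta> where "\<eta> > 0" and \<eta>: "\<And>x y. x \<in> {a..t} \<Longrightarrow> y \<in> {a..t} \<Longrightarrow> \<bar>x - y\<bar> < \<eta> \<Longrightarrow>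
        \<bar>w x - w y\<bar> < min 1 (\<epsilon> / K)"
    proof (rule uniform_modulus_on_interval[OF w, of "min 1 (\<epsilon> / K)"])
      show "0 < min 1 (\<epsilon> / K)" using \<open>\<epsilon> > 0\<close> K(1) by simp
    qed (rule that)
    have "\<bar>A s u\<bar> \<le> \<epsilon> * (w u - w s)\<^sup>2" if "a \<le> s" "s < u" "u \<le> t" "u - s < \<eta>" for s u
    proof -
      let ?x = "w u - w s"
      have x: "\<bar>?x\<bar> < min 1 (\<epsilon> / K)" using that by (intro \<eta>) auto
      have "\<bar>A s u\<bar> \<le> K * (\<bar>?x\<bar> * ?x\<^sup>2)"
        unfolding A_def abs_mult using that x K(1)
        by (intro mult_mono K(2) exp_second_order_remainder) auto
      also have "\<dots> \<le> K * (\<epsilon> / K * ?x\<^sup>2)"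
        using x K(1) by (intro mult_left_mono mult_right_mono) auto
      finally show ?thesis using K(1) by simp
    qed
    then show "\<exists>\<eta>>0. \<forall>s u. a \<le> s \<longrightarrow> s < u \<longrightarrow> u \<le> t \<longrightarrow> u - s < \<eta> \<longrightarrow>
        \<bar>A s u\<bar> \<le> \<epsilon> * (w u - w s)\<^sup>2"
      using \<open>\<eta> > 0\<close> by blast
  qed

  have B0: "(partition_sum B \<longlongrightarrow> 0) F"
  proof (rule partition_sum_negligible[OF F, where g = "\<lambda>s u. u - s" and B = "t - a"])
    show "\<forall>\<^sub>F P in F. partition_sum (\<lambda>s u. u - s) P \<le> t - a"
      using part by eventually_elim (simp add: partition_sum_telescope[where F = "\<lambda>x. x"])
    fix \<epsilon> :: real assume "\<epsilon> > 0"
    obtain K where K: "K > 0" "\<And>x. x \<in> {a..t} \<Longrightarrow> \<bar>h' x\<bar> \<le> K"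
      using bound[OF h'] by blast
    have "continuous_on {a..t} (\<lambda>x. exp (w x))"
      by (intro continuous_intros w)
    then obtain \<eta>1 where "\<eta>1 > 0" and
      \<eta>1: "\<And>x y. x \<in> {a..t} \<Longrightarrow> y \<in> {a..t} \<Longrightarrow> \<bar>x - y\<bar> < \<eta>1 \<Longrightarrow>
        \<bar>exp (w x) - exp (w y)\<bar> < \<epsilon> / (2 * K)"
    proof (rule uniform_modulus_on_interval[of _ _ _ "\<epsilon> / (2 * K)"])
      show "0 < \<epsilon> / (2 * K)" using \<open>\<epsilon> > 0\<close> K(1) by simp
    qed (rule that)
    obtain \<eta>2 where "\<eta>2 > 0" and
      \<eta>2: "\<And>x y. x \<in> {a..t} \<Longrightarrow> y \<in> {a..t} \<Longrightarrow> \<bar>x - y\<bar> < \<eta>2 \<Longrightarrow> \<bar>G x - G y\<bar> < \<epsilon>"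
      by (rule uniform_modulus_on_interval[OF G \<open>\<epsilon> > 0\<close>]) (rule that)
    have "\<bar>B s u\<bar> \<le> \<epsilon> * (u - s)"
      if su: "a \<le> s" "s < u" "u \<le> t" "u - s < min \<eta>1 \<eta>2" for s u
    proof -
      \<comment> \<open>With the rough factors frozen at end points, \<open>B\<close> is the increment of a differentiable function.\<close>
      let ?f = "\<lambda>x. exp (w u) * h x + 1/2 * G s * x - V x"
      have "norm (?f u - ?f s) \<le> \<epsilon> * norm (u - s)"
      proof (rule field_differentiable_bound[where S = "{s..u}" and x = u and y = s
            and f = ?f and f' = "\<lambda>x. (exp (w u) - exp (w x)) * h' x + 1/2 * (G s - G x)"])
        fix x assume x: "x \<in> {s..u}"
        have "(h has_real_derivative h' x) (at x within {s..u})"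
          by (rule DERIV_subset[OF h]) (use x su in auto)
        moreover have "(V has_real_derivative exp (w x) * h' x + 1/2 * G x) (at x within {s..u})"
          unfolding G_def by (rule DERIV_subset[OF V]) (use x su in auto)
        ultimately have "(?f has_real_derivative
            exp (w u) * h' x + 1/2 * G s - (exp (w x) * h' x + 1/2 * G x)) (at x within {s..u})"
          by (intro DERIV_diff DERIV_add DERIV_cmult DERIV_cmult_Id)
        then show "(?f has_real_derivative
            (exp (w u) - exp (w x)) * h' x + 1/2 * (G s - G x)) (at x within {s..u})"
          by (rule DERIV_cong) (simp add: field_simps)
        have half: "\<bar>y + 1/2 * z\<bar> \<le> \<epsilon>" if "\<bar>y\<bar> \<le> \<epsilon> / 2" "\<bar>z\<bar> \<le> \<epsilon>" for y z :: real
          using that by linarith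
        have "\<bar>(exp (w u) - exp (w x)) * h' x\<bar> \<le> \<epsilon> / (2 * K) * K"
          unfolding abs_mult using x su K(1) \<open>\<epsilon> > 0\<close>
          by (intro mult_mono K(2) less_imp_le[OF \<eta>1]) auto
        moreover have "\<bar>G s - G x\<bar> \<le> \<epsilon>"
          using x su by (intro less_imp_le[OF \<eta>2]) auto
        ultimately show "norm ((exp (w u) - exp (w x)) * h' x + 1/2 * (G s - G x)) \<le> \<epsilon>"
          unfolding real_norm_def using K(1) by (intro half) auto
      qed (use su in auto)
      moreover have "B s u = ?f u - ?f s" by (simp add: B_def field_simps)
      ultimately show ?thesis using su by simp
    qed
    then show "\<exists>\<eta>>0. \<forall>s u. a \<le> s \<longrightarrow> s < u \<longrightarrow> u \<le> t \<longrightarrow> u - s < \<eta> \<longrightarrow> \<bar>B s u\<bar> \<le> \<epsilon> * (u - s)"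
      using \<open>\<eta>1 > 0\<close> \<open>\<eta>2 > 0\<close> by (intro exI[of _ "min \<eta>1 \<eta>2"]) auto
  qed

  let ?d = "\<lambda>s u. (w u - w s)\<^sup>2 - (u - s)"
  let ?I = "\<lambda>s u. G s * (w u - w s)"
  have expand: "?I s u = ((G u - V u) - (G s - V s)) - (A s u + B s u) - 1/2 * (G s * ?d s u)" for s u
  proof -
    have "exp (w u) = exp (w s) * exp (w u - w s)"
      by (simp add: exp_add[symmetric])
    then have "G s * exp (w u - w s) = exp (w u) * h s"
      by (simp add: G_def)
    then have "A s u = exp (w u) * h s - G s - G s * (w u - w s) - G s * (w u - w s)\<^sup>2 / 2"
      by (simp add: A_def algebra_simps)
    then show ?thesis by (simp add: B_def G_def field_simps)
  qed
  have "((\<lambda>P. (G t - V t) - (G a - V a) - (partition_sum A P + partition_sum B P)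
      - 1/2 * partition_sum (\<lambda>s u. G s * ?d s u) P) \<longlongrightarrow> (G t - V t) - (G a - V a) - (0 + 0) - 1/2 * 0) F"
    by (intro tendsto_intros A0 B0 weighted_quadratic_variation[OF F qv G])
  moreover have "\<forall>\<^sub>F P in F. (G t - V t) - (G a - V a) - (partition_sum A P + partition_sum B P)
      - 1/2 * partition_sum (\<lambda>s u. G s * ?d s u) P = partition_sum ?I P"
    using part
  proof eventually_elim
    case (elim P)
    show ?case
      unfolding expand partition_sum_diff[of _ "\<lambda>s u. 1/2 * (G s * ?d s u)"]
        partition_sum_diff[of _ "\<lambda>s u. A s u + B s u"] partition_sum_add partition_sum_cmult
        partition_sum_telescope[OF elim, of "\<lambda>x. G x - V x"] by simp
  qed
  ultimately have "(partition_sum ?I \<longlongrightarrow> (G t - V t) - (G a - V a) - (0 + 0) - 1/2 * 0) F"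
    by (rule Lim_transform_eventually)
  then show ?thesis by (simp add: G_def algebra_simps)
qed

section \<open>Quadratic variation of Brownian motion\<close>

lemma (in prob_space) expectation_square_sum_indep:
  fixes Y :: "'i \<Rightarrow> 'a \<Rightarrow> real"
  assumes I: "finite I" and indep: "indep_vars (\<lambda>_. borel) Y I"
    and int: "\<And>i. i \<in> I \<Longrightarrow> integrable M (Y i)"
    and int2: "\<And>i. i \<in> I \<Longrightarrow> integrable M (\<lambda>\<omega>. (Y i \<omega>)\<^sup>2)"
    and zero: "\<And>i. i \<in> I \<Longrightarrow> expectation (Y i) = 0"
  shows "integrable M (\<lambda>\<omega>. (\<Sum>i\<in>I. Y i \<omega>)\<^sup>2)"
    and "expectation (\<lambda>\<omega>. (\<Sum>i\<in>I. Y i \<omega>)\<^sup>2) = (\<Sum>i\<in>I. expectation (\<lambda>\<omega>. (Y i \<omega>)\<^sup>2))"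
proof -
  have sq: "(\<Sum>i\<in>I. Y i \<omega>)\<^sup>2 = (\<Sum>i\<in>I. \<Sum>j\<in>I. Y i \<omega> * Y j \<omega>)" for \<omega>
    by (simp add: power2_eq_square sum_product)
  have cross: "integrable M (\<lambda>\<omega>. Y i \<omega> * Y j \<omega>)"
    "expectation (\<lambda>\<omega>. Y i \<omega> * Y j \<omega>) = (if i = j then expectation (\<lambda>\<omega>. (Y i \<omega>)\<^sup>2) else 0)"
    if "i \<in> I" "j \<in> I" for i j
  proof -
    have "integrable M (\<lambda>\<omega>. Y i \<omega> * Y j \<omega>) \<and> expectation (\<lambda>\<omega>. Y i \<omega> * Y j \<omega>) = 0" if "i \<noteq> j"
    proof -
      have "indep_vars (\<lambda>_. borel) Y {i, j}"
        using \<open>i \<in> I\<close> \<open>j \<in> I\<close> by (intro indep_vars_subset[OF indep]) auto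
      from indep_vars_integrable[OF _ this] indep_vars_lebesgue_integral[OF _ this]
      show ?thesis using \<open>i \<in> I\<close> \<open>j \<in> I\<close> that int zero by auto
    qed
    then show "integrable M (\<lambda>\<omega>. Y i \<omega> * Y j \<omega>)"
      "expectation (\<lambda>\<omega>. Y i \<omega> * Y j \<omega>) = (if i = j then expectation (\<lambda>\<omega>. (Y i \<omega>)\<^sup>2) else 0)"
      using int2[OF \<open>i \<in> I\<close>] by (auto simp: power2_eq_square)
  qed
  show "integrable M (\<lambda>\<omega>. (\<Sum>i\<in>I. Y i \<omega>)\<^sup>2)"
    unfolding sq by (intro Bochner_Integration.integrable_sum cross)
  have "expectation (\<lambda>\<omega>. (\<Sum>i\<in>I. Y i \<omega>)\<^sup>2) = (\<Sum>i\<in>I. \<Sum>j\<in>I. expectation (\<lambda>\<omega>. Y i \<omega> * Y j \<omega>))"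
    unfolding sq using cross(1)
    by (simp add: Bochner_Integration.integral_sum Bochner_Integration.integrable_sum)
  also have "\<dots> = (\<Sum>i\<in>I. \<Sum>j\<in>I. if i = j then expectation (\<lambda>\<omega>. (Y i \<omega>)\<^sup>2) else 0)"
    by (intro sum.cong refl cross(2))
  also have "\<dots> = (\<Sum>i\<in>I. expectation (\<lambda>\<omega>. (Y i \<omega>)\<^sup>2))"
    using I by simp
  finally show "expectation (\<lambda>\<omega>. (\<Sum>i\<in>I. Y i \<omega>)\<^sup>2) = (\<Sum>i\<in>I. expectation (\<lambda>\<omega>. (Y i \<omega>)\<^sup>2))" .
qed

text \<open>The sum of all the squares has finite expectation, hence is almost surely finite.\<close>

lemma AE_tendsto_zero_of_summable_second_moments:
  fixes Y :: "nat \<Rightarrow> 'a \<Rightarrow> real"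
  assumes int: "\<And>k. integrable M (\<lambda>\<omega>. (Y k \<omega>)\<^sup>2)"
    and le: "\<And>k. (\<integral>\<omega>. (Y k \<omega>)\<^sup>2 \<partial>M) \<le> c k" and c: "summable c"
  shows "AE \<omega> in M. (\<lambda>k. Y k \<omega>) \<longlonglongrightarrow> 0"
proof -
  have [measurable]: "(\<lambda>\<omega>. (Y k \<omega>)\<^sup>2) \<in> borel_measurable M" for k
    using int by (rule borel_measurable_integrable)
  have "summable (\<lambda>k. \<integral>\<omega>. (Y k \<omega>)\<^sup>2 \<partial>M)"
    by (rule summable_comparison_test'[OF c, of 0]) (simp add: le)
  then have "(\<Sum>k. ennreal (\<integral>\<omega>. (Y k \<omega>)\<^sup>2 \<partial>M)) \<noteq> \<infinity>"
    using ennreal_suminf_neq_top by simp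
  also have "(\<Sum>k. ennreal (\<integral>\<omega>. (Y k \<omega>)\<^sup>2 \<partial>M)) = (\<Sum>k. \<integral>\<^sup>+\<omega>. ennreal ((Y k \<omega>)\<^sup>2) \<partial>M)"
    using int by (simp add: nn_integral_eq_integral)
  also have "\<dots> = (\<integral>\<^sup>+\<omega>. (\<Sum>k. ennreal ((Y k \<omega>)\<^sup>2)) \<partial>M)"
    by (rule nn_integral_suminf[symmetric]) measurable
  finally have "AE \<omega> in M. (\<Sum>k. ennreal ((Y k \<omega>)\<^sup>2)) \<noteq> \<infinity>"
    by (intro nn_integral_PInf_AE) measurable
  then show ?thesis
  proof eventually_elim
    case (elim \<omega>)
    then have "summable (\<lambda>k. (Y k \<omega>)\<^sup>2)"
      by (intro summable_suminf_not_top) auto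
    then have "(\<lambda>k. (Y k \<omega>)\<^sup>2) \<longlonglongrightarrow> 0"
      by (rule summable_LIMSEQ_zero)
    then have "(\<lambda>k. sqrt ((Y k \<omega>)\<^sup>2)) \<longlonglongrightarrow> sqrt 0"
      by (rule tendsto_real_sqrt)
    then show ?case by (simp add: tendsto_rabs_zero_iff)
  qed
qed

context two_sided_brownian_motion
begin

lemma increment_even_moment:
  assumes "s < u"
  shows "integrable M (\<lambda>\<omega>. (W u \<omega> - W s \<omega>) ^ (2 * k))"
    and "expectation (\<lambda>\<omega>. (W u \<omega> - W s \<omega>) ^ (2 * k)) = fact (2 * k) / ((2 / (u - s)) ^ k * fact k)"
proof -
  note D = gaussian_increments[OF assms]
  have "0 < sqrt (u - s)" using assms by simp
  note mom = normal_moment_even[OF this, of 0 k]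
  show "integrable M (\<lambda>\<omega>. (W u \<omega> - W s \<omega>) ^ (2 * k))"
    using distributed_integrable[OF D, of "\<lambda>x. x ^ (2 * k)"] mom
    by (auto simp: has_bochner_integral_iff)
  show "expectation (\<lambda>\<omega>. (W u \<omega> - W s \<omega>) ^ (2 * k)) = fact (2 * k) / ((2 / (u - s)) ^ k * fact k)"
    using distributed_integral[OF D, of "\<lambda>x. x ^ (2 * k)"] mom assms
    by (auto simp: has_bochner_integral_iff)
qed

lemma centred_square_increment:
  assumes "s < u"
  shows "integrable M (\<lambda>\<omega>. (W u \<omega> - W s \<omega>)\<^sup>2 - (u - s))"
    and "expectation (\<lambda>\<omega>. (W u \<omega> - W s \<omega>)\<^sup>2 - (u - s)) = 0"
    and "integrable M (\<lambda>\<omega>. ((W u \<omega> - W s \<omega>)\<^sup>2 - (u - s))\<^sup>2)"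
    and "expectation (\<lambda>\<omega>. ((W u \<omega> - W s \<omega>)\<^sup>2 - (u - s))\<^sup>2) = 2 * (u - s)\<^sup>2"
proof -
  have m2: "integrable M (\<lambda>\<omega>. (W u \<omega> - W s \<omega>)\<^sup>2)"
    "expectation (\<lambda>\<omega>. (W u \<omega> - W s \<omega>)\<^sup>2) = u - s"
    using increment_even_moment[OF assms, of 1] by simp_all
  have m4: "integrable M (\<lambda>\<omega>. (W u \<omega> - W s \<omega>) ^ 4)"
    "expectation (\<lambda>\<omega>. (W u \<omega> - W s \<omega>) ^ 4) = 3 * (u - s)\<^sup>2"
    using increment_even_moment[OF assms, of 2]
    by (simp_all add: power_divide fact_numeral)
  show "integrable M (\<lambda>\<omega>. (W u \<omega> - W s \<omega>)\<^sup>2 - (u - s))"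
    "expectation (\<lambda>\<omega>. (W u \<omega> - W s \<omega>)\<^sup>2 - (u - s)) = 0"
    using m2 by (simp_all add: prob_space)
  have square: "(z\<^sup>2 - v)\<^sup>2 = z ^ 4 - 2 * v * z\<^sup>2 + v\<^sup>2" for z v :: real
    by (simp add: power2_eq_square power4_eq_xxxx algebra_simps)
  have eq: "((W u \<omega> - W s \<omega>)\<^sup>2 - (u - s))\<^sup>2 =
      (W u \<omega> - W s \<omega>) ^ 4 - 2 * (u - s) * (W u \<omega> - W s \<omega>)\<^sup>2 + (u - s)\<^sup>2" for \<omega>
    by (rule square)
  show "integrable M (\<lambda>\<omega>. ((W u \<omega> - W s \<omega>)\<^sup>2 - (u - s))\<^sup>2)"
    unfolding eq using m2(1) m4(1) by simp
  have "expectation (\<lambda>\<omega>. (W u \<omega> - W s \<omega>) ^ 4 - 2 * (u - s) * (W u \<omega> - W s \<omega>)\<^sup>2 + (u - s)\<^sup>2) =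
      3 * (u - s)\<^sup>2 - 2 * (u - s) * (u - s) + (u - s)\<^sup>2"
    using m2 m4 by (simp add: prob_space)
  then show "expectation (\<lambda>\<omega>. ((W u \<omega> - W s \<omega>)\<^sup>2 - (u - s))\<^sup>2) = 2 * (u - s)\<^sup>2"
    unfolding eq by (simp add: power2_eq_square)
qed

text \<open>Each interval contributes \<open>2 q(s)\<^sup>2 (u - s)\<^sup>2\<close>, as the fourth moment of a centred Gaussian is
  three times its squared variance; one factor \<open>u - s\<close> is estimated by the mesh and the other
  sums up to \<open>t - a\<close>.\<close>

lemma weighted_quadratic_variation_second_moment:
  fixes q :: "real \<Rightarrow> real"
  assumes P: "is_partition a t P" "mesh_less \<eta> P"
    and q: "\<And>s. s \<in> {a..t} \<Longrightarrow> \<bar>q s\<bar> \<le> C"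
  shows "integrable M (\<lambda>\<omega>. (partition_sum (\<lambda>s u. q s * ((W u \<omega> - W s \<omega>)\<^sup>2 - (u - s))) P)\<^sup>2)"
    and "expectation (\<lambda>\<omega>. (partition_sum (\<lambda>s u. q s * ((W u \<omega> - W s \<omega>)\<^sup>2 - (u - s))) P)\<^sup>2)
      \<le> 2 * C\<^sup>2 * (t - a) * \<eta>"
proof -
  obtain n p where P_eq: "P = (n, p)" by (cases P)
  have step: "p i < p (Suc i)" "p (Suc i) - p i < \<eta>" "\<bar>q (p i)\<bar> \<le> C" if "i < n" for i
  proof -
    show "p i < p (Suc i)" "p (Suc i) - p i < \<eta>"
      using P that by (auto simp: P_eq is_partition_def mesh_less_def)
    show "\<bar>q (p i)\<bar> \<le> C"
      using is_partition_bounds[of a t n p i] P(1) that by (intro q) (auto simp: P_eq)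
  qed
  define Z where "Z i \<omega> = W (p (Suc i)) \<omega> - W (p i) \<omega>" for i \<omega>
  define Y where "Y i \<omega> = q (p i) * ((Z i \<omega>)\<^sup>2 - (p (Suc i) - p i))" for i \<omega>
  have sum_eq: "partition_sum (\<lambda>s u. q s * ((W u \<omega> - W s \<omega>)\<^sup>2 - (u - s))) P = (\<Sum>i<n. Y i \<omega>)" for \<omega>
    by (simp add: P_eq partition_sum_def Y_def Z_def)
  have "indep_vars (\<lambda>_. borel) Z {..<n}"
    using indep_increments[of n p] step unfolding Z_def by blast
  then have indep: "indep_vars (\<lambda>_. borel) Y {..<n}"
    unfolding Y_def
    by (rule indep_vars_compose2[where Y = "\<lambda>i x. q (p i) * (x\<^sup>2 - (p (Suc i) - p i))"]) simp
  have Y: "integrable M (Y i)" "expectation (Y i) = 0" "integrable M (\<lambda>\<omega>. (Y i \<omega>)\<^sup>2)"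
    "expectation (\<lambda>\<omega>. (Y i \<omega>)\<^sup>2) = (q (p i))\<^sup>2 * (2 * (p (Suc i) - p i)\<^sup>2)" if "i < n" for i
    using centred_square_increment[OF step(1)[OF that]]
    by (simp_all add: Y_def[abs_def] Z_def power_mult_distrib)
  show "integrable M (\<lambda>\<omega>. (partition_sum (\<lambda>s u. q s * ((W u \<omega> - W s \<omega>)\<^sup>2 - (u - s))) P)\<^sup>2)"
    unfolding sum_eq using indep Y by (intro expectation_square_sum_indep(1)) auto
  have "expectation (\<lambda>\<omega>. (\<Sum>i<n. Y i \<omega>)\<^sup>2) = (\<Sum>i<n. expectation (\<lambda>\<omega>. (Y i \<omega>)\<^sup>2))"
    using indep Y by (intro expectation_square_sum_indep(2)) auto
  also have "\<dots> = (\<Sum>i<n. (q (p i))\<^sup>2 * (2 * (p (Suc i) - p i)\<^sup>2))"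
    by (intro sum.cong) (auto simp: Y)
  also have "\<dots> \<le> (\<Sum>i<n. C\<^sup>2 * (2 * (\<eta> * (p (Suc i) - p i))))"
  proof (intro sum_mono mult_mono)
    fix i assume "i \<in> {..<n}"
    then have i: "i < n" by simp
    show "(q (p i))\<^sup>2 \<le> C\<^sup>2"
      using step(3)[OF i] by (intro abs_le_square_iff[THEN iffD1]) auto
    show "(p (Suc i) - p i)\<^sup>2 \<le> \<eta> * (p (Suc i) - p i)"
      unfolding power2_eq_square using step[OF i] by (intro mult_right_mono) auto
  qed auto
  also have "\<dots> = 2 * C\<^sup>2 * \<eta> * (\<Sum>i<n. p (Suc i) - p i)"
    unfolding sum_distrib_left by (intro sum.cong) (simp_all add: algebra_simps)
  also have "(\<Sum>i<n. p (Suc i) - p i) = t - a"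
    using partition_sum_telescope[OF P(1), of "\<lambda>x. x"] by (simp add: P_eq partition_sum_def)
  finally show "expectation (\<lambda>\<omega>. (partition_sum (\<lambda>s u. q s * ((W u \<omega> - W s \<omega>)\<^sup>2 - (u - s))) P)\<^sup>2)
      \<le> 2 * C\<^sup>2 * (t - a) * \<eta>"
    unfolding sum_eq by (simp add: mult_ac)
qed

lemma AE_monomial_quadratic_variation:
  assumes P: "\<And>k::nat. is_partition a t (P k)" "\<And>k. mesh_less (1/2^k) (P k)"
  shows "AE \<omega> in M. \<forall>m::nat.
    (\<lambda>k. partition_sum (\<lambda>s u. s ^ m * ((W u \<omega> - W s \<omega>)\<^sup>2 - (u - s))) (P k)) \<longlonglongrightarrow> 0"
  unfolding AE_all_countable
proof
  fix m :: nat
  define C where "C = (\<bar>a\<bar> + \<bar>t\<bar>) ^ m"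
  have C: "\<bar>s ^ m\<bar> \<le> C" if "s \<in> {a..t}" for s
    unfolding C_def power_abs using that by (intro power_mono) auto
  show "AE \<omega> in M. (\<lambda>k. partition_sum (\<lambda>s u. s ^ m * ((W u \<omega> - W s \<omega>)\<^sup>2 - (u - s))) (P k)) \<longlonglongrightarrow> 0"
  proof (rule AE_tendsto_zero_of_summable_second_moments)
    show "integrable M (\<lambda>\<omega>. (partition_sum (\<lambda>s u. s ^ m * ((W u \<omega> - W s \<omega>)\<^sup>2 - (u - s))) (P k))\<^sup>2)"
      "expectation (\<lambda>\<omega>. (partition_sum (\<lambda>s u. s ^ m * ((W u \<omega> - W s \<omega>)\<^sup>2 - (u - s))) (P k))\<^sup>2)
        \<le> 2 * C\<^sup>2 * (t - a) * (1/2^k)" for k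
      using weighted_quadratic_variation_second_moment[OF P, of "\<lambda>s. s ^ m" C k] C by blast+
    show "summable (\<lambda>k. 2 * C\<^sup>2 * (t - a) * (1/2^k))"
      using summable_geometric[of "1/2::real"]
      by (intro summable_mult) (simp add: power_one_over)
  qed
qed

end

section \<open>From almost sure convergence along sequences to convergence in probability\<close>

lemma (in prob_space) measure_tendsto_zero_of_AE_tendsto:
  fixes X :: "nat \<Rightarrow> 'a \<Rightarrow> real"
  assumes [measurable]: "\<And>k. X k \<in> borel_measurable M" "I \<in> borel_measurable M"
    and AE: "AE \<omega> in M. (\<lambda>k. X k \<omega>) \<longlonglongrightarrow> I \<omega>" and "\<epsilon> > 0"
  shows "(\<lambda>k. prob {\<omega> \<in> space M. \<bar>X k \<omega> - I \<omega>\<bar> > \<epsilon>}) \<longlonglongrightarrow> 0"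
proof -
  let ?A = "\<lambda>k. {\<omega> \<in> space M. \<bar>X k \<omega> - I \<omega>\<bar> > \<epsilon>}"
  have "(\<lambda>k. expectation (indicator (?A k) :: 'a \<Rightarrow> real)) \<longlonglongrightarrow> expectation (\<lambda>_. 0 :: real)"
  proof (rule integral_dominated_convergence[where w = "\<lambda>_. 1"])
    show "AE \<omega> in M. (\<lambda>k. indicator (?A k) \<omega> :: real) \<longlonglongrightarrow> 0"
      using AE
    proof eventually_elim
      case (elim \<omega>)
      then have "\<forall>\<^sub>F k in sequentially. \<bar>X k \<omega> - I \<omega>\<bar> < \<epsilon>"
        using tendstoD[OF elim \<open>\<epsilon> > 0\<close>] by (simp add: dist_real_def)
      then have "\<forall>\<^sub>F k in sequentially. 0 = (indicator (?A k) \<omega> :: real)"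
        by eventually_elim (simp add: indicator_def)
      with tendsto_const show ?case by (rule Lim_transform_eventually)
    qed
  qed (auto simp: indicator_def)
  then show ?thesis by simp
qed

text \<open>The map \<open>S P\<close> need not be measurable; it agrees with the random variable \<open>S' P\<close> off a null
  set that is the same for all \<open>P\<close>. The mesh \<open>2\<^sup>-\<^sup>k\<close> can be prescribed since a
  failure of convergence provides bad partitions of arbitrarily small mesh.\<close>

lemma (in prob_space) conv_in_prob_partition_filterI:
  assumes N: "N \<in> null_sets M"
    and version: "\<And>P \<omega>. \<omega> \<in> space M - N \<Longrightarrow> S P \<omega> = S' P \<omega>"
    and meas: "\<And>P. is_partition a t P \<Longrightarrow> S' P \<in> borel_measurable M"
    and I: "I \<in> borel_measurable M"
    and conv: "\<And>P. (\<And>k::nat. is_partition a t (P k)) \<Longrightarrow> (\<And>k. mesh_less (1/2^k) (P k)) \<Longrightarrow>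
      AE \<omega> in M. (\<lambda>k. S (P k) \<omega>) \<longlonglongrightarrow> I \<omega>"
  shows "conv_in_prob M S I (partition_filter a t)"
  unfolding conv_in_prob_def
proof (intro allI impI)
  fix \<epsilon> \<delta> :: real
  assume "\<epsilon> > 0" "\<delta> > 0"
  let ?Q = "\<lambda>P. \<exists>E\<in>sets M. {\<omega> \<in> space M. \<bar>S P \<omega> - I \<omega>\<bar> > \<epsilon>} \<subseteq> E \<and> prob E < \<delta>"
  show "eventually ?Q (partition_filter a t)"
  proof (rule ccontr)
    assume "\<not> eventually ?Q (partition_filter a t)"
    then have "\<exists>P. is_partition a t P \<and> mesh_less (1/2^k) P \<and> \<not> ?Q P" for k :: nat
      unfolding eventually_partition_filter by (auto dest!: spec[of _ "1/2^k"])
    then obtain P where P: "\<And>k::nat. is_partition a t (P k)" "\<And>k. mesh_less (1/2^k) (P k)"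
      and notQ: "\<And>k. \<not> ?Q (P k)"
      by metis
    have "AE \<omega> in M. (\<lambda>k. S' (P k) \<omega>) \<longlonglongrightarrow> I \<omega>"
      using conv[OF P] AE_not_in[OF N] AE_space
      by eventually_elim (simp add: version)
    then have "(\<lambda>k. prob {\<omega> \<in> space M. \<bar>S' (P k) \<omega> - I \<omega>\<bar> > \<epsilon>}) \<longlonglongrightarrow> 0"
      using meas[OF P(1)] I \<open>\<epsilon> > 0\<close> by (intro measure_tendsto_zero_of_AE_tendsto)
    then have "\<forall>\<^sub>F k in sequentially. prob {\<omega> \<in> space M. \<bar>S' (P k) \<omega> - I \<omega>\<bar> > \<epsilon>} < \<delta>"
      using \<open>\<delta> > 0\<close> by (rule order_tendstoD)
    then obtain k where k: "prob {\<omega> \<in> space M. \<bar>S' (P k) \<omega> - I \<omega>\<bar> > \<epsilon>} < \<delta>"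
      using eventually_happens'[OF sequentially_bot] by blast
    let ?E = "{\<omega> \<in> space M. \<bar>S' (P k) \<omega> - I \<omega>\<bar> > \<epsilon>}"
    have E: "?E \<in> sets M"
      using meas[OF P(1)[of k]] I by measurable
    have "?E \<union> N \<in> sets M" using E N by auto
    moreover have "{\<omega> \<in> space M. \<bar>S (P k) \<omega> - I \<omega>\<bar> > \<epsilon>} \<subseteq> ?E \<union> N"
      using version[of _ "P k"] by auto
    moreover have "prob (?E \<union> N) < \<delta>"
      using measure_Un_null_set[OF E N] k by simp
    ultimately show False using notQ[of k] by blast
  qed
qed

lemma measurable_partition_sum:
  assumes P: "is_partition a t P"
    and f: "\<And>s u. s \<in> {a..t} \<Longrightarrow> u \<in> {a..t} \<Longrightarrow> (\<lambda>\<omega>. f \<omega> s u) \<in> borel_measurable M"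
  shows "(\<lambda>\<omega>. partition_sum (f \<omega>) P) \<in> borel_measurable M"
proof (cases P)
  case (Pair n p)
  have "(\<lambda>\<omega>. f \<omega> (p i) (p (Suc i))) \<in> borel_measurable M" if "i < n" for i
    using is_partition_bounds[of a t n p] P that Pair by (intro f) auto
  then show ?thesis
    unfolding Pair partition_sum_def prod.case by (intro borel_measurable_sum) auto
qed

section \<open>Eigenfunctions\<close>

text \<open>On the interval, \<open>exp (- w) * f'\<close> coincides with the smooth factor \<open>g\<close> that membership in
  the domain provides. Working with this explicit expression makes \<open>exp w\<close> times it equal to
  \<open>f'\<close> at every real point.\<close>

lemma eigenpair_derivatives:
  assumes "a < b" and eig: "eigenpair a b w l f" and x: "x \<in> {a..b}"
  shows "(f has_real_derivative ivl_deriv a b f x) (at x within {a..b})"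
    and "((\<lambda>y. exp (- w y) * ivl_deriv a b f y) has_real_derivative
      - 2 * l * exp (- w x) * f x) (at x within {a..b})"
proof -
  let ?h = "\<lambda>y. exp (- w y) * ivl_deriv a b f y"
  have "f \<in> L_dom a b w" using eig by (simp add: eigenpair_def)
  then obtain g where f: "f differentiable_on {a..b}" and g: "C1_ivl a b g"
    and fg: "\<And>y. y \<in> {a..b} \<Longrightarrow> ivl_deriv a b f y = exp (w y) * g y"
    unfolding L_dom_def by blast
  have deriv: "(k has_vector_derivative ivl_deriv a b k x) (at x within {a..b})"
    if "k differentiable_on {a..b}" for k :: "real \<Rightarrow> real"
    using that x unfolding ivl_deriv_def differentiable_on_def
    by (simp add: vector_derivative_works)
  show "(f has_real_derivative ivl_deriv a b f x) (at x within {a..b})"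
    using deriv[OF f] by (simp add: has_real_derivative_iff_has_vector_derivative)
  have hg: "?h y = g y" if "y \<in> {a..b}" for y
    using fg[OF that] by (simp add: exp_minus)
  have h: "(?h has_vector_derivative ivl_deriv a b g x) (at x within {a..b})"
  proof (rule has_vector_derivative_transform[of x "{a..b}" ?h g])
    show "(g has_vector_derivative ivl_deriv a b g x) (at x within {a..b})"
      using deriv g by (simp add: C1_ivl_def)
  qed (use x hg in auto)
  then have "ivl_deriv a b ?h x = ivl_deriv a b g x"
    unfolding ivl_deriv_def[of a b ?h] by (rule vector_derivative_within_closed_interval[OF \<open>a < b\<close> x])
  moreover have "exp (w x) / 2 * ivl_deriv a b ?h x + l * f x = 0"
    using eig x by (simp add: eigenpair_def L_op_def)
  ultimately have "exp (w x) * ivl_deriv a b g x = - 2 * l * f x" by simp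
  then have "ivl_deriv a b g x = - 2 * l * exp (- w x) * f x"
    by (simp add: exp_minus field_simps)
  with h show "(?h has_real_derivative - 2 * l * exp (- w x) * f x) (at x within {a..b})"
    by (simp add: has_real_derivative_iff_has_vector_derivative)
qed

lemma eigenpair_continuous:
  assumes "a < b" and eig: "eigenpair a b w l f" and w: "continuous_on {a..b} w"
  shows "continuous_on {a..b} f" "continuous_on {a..b} (ivl_deriv a b f)"
proof -
  note D = eigenpair_derivatives[OF assms(1) eig]
  show "continuous_on {a..b} f" using D(1) by (rule DERIV_continuous_on)
  have "continuous_on {a..b} (\<lambda>y. exp (- w y) * ivl_deriv a b f y)"
    using D(2) by (rule DERIV_continuous_on)
  then have "continuous_on {a..b} (\<lambda>y. exp (w y) * (exp (- w y) * ivl_deriv a b f y))"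
    by (rule continuous_on_mult[OF continuous_on_exp[OF w]])
  then show "continuous_on {a..b} (ivl_deriv a b f)"
    by (simp add: mult.assoc[symmetric] exp_add[symmetric])
qed

text \<open>The term \<open>integral {a..a} j\<close> is zero; it gives the drift integral the shape of an increment
  of the antiderivative.\<close>

lemma eigenpair_drift_antiderivative:
  assumes "a < b" and eig: "eigenpair a b w l f" and w: "continuous_on {a..b} w"
    and t: "t \<in> {a..b}"
  defines "j \<equiv> \<lambda>r. - 2 * l * f r + 1/2 * ivl_deriv a b f r"
  shows "continuous_on {a..t} j" "set_integrable lborel {a..t} j"
    and "\<And>x. x \<in> {a..t} \<Longrightarrow>
      ((\<lambda>x. integral {a..x} j) has_real_derivative j x) (at x within {a..t})"
    and "(LINT r:{a..t}|lborel. j r) = integral {a..t} j - integral {a..a} j"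
proof -
  have "continuous_on {a..b} j"
    unfolding j_def by (intro continuous_intros eigenpair_continuous[OF assms(1) eig w])
  then show j: "continuous_on {a..t} j"
    by (rule continuous_on_subset) (use t in auto)
  then show int: "set_integrable lborel {a..t} j"
    by (rule borel_integrable_atLeastAtMost')
  show "((\<lambda>x. integral {a..x} j) has_real_derivative j x) (at x within {a..t})" if "x \<in> {a..t}" for x
    using integral_has_vector_derivative[OF j that]
    by (simp add: has_real_derivative_iff_has_vector_derivative)
  show "(LINT r:{a..t}|lborel. j r) = integral {a..t} j - integral {a..a} j"
    using set_borel_integral_eq_integral(2)[OF int] by simp
qed

lemma eigenpair_pathwise_forward_integral:
  assumes "a < b" and eig: "eigenpair a b w l f" and w: "continuous_on {a..b} w"
    and t: "t \<in> {a..b}" and F: "F \<le> partition_filter a t"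
    and qv: "\<And>m. (partition_sum (\<lambda>s u. s ^ m * ((w u - w s)\<^sup>2 - (u - s))) \<longlongrightarrow> 0) F"
  shows "(partition_sum (\<lambda>s u. ivl_deriv a b f s * (w u - w s)) \<longlongrightarrow>
    ivl_deriv a b f t - ivl_deriv a b f a -
      (LINT r:{a..t}|lborel. - 2 * l * f r + 1/2 * ivl_deriv a b f r)) F"
proof -
  define h where "h y = exp (- w y) * ivl_deriv a b f y" for y
  define h' where "h' y = - 2 * l * exp (- w y) * f y" for y
  define j where "j = (\<lambda>r. - 2 * l * f r + 1/2 * ivl_deriv a b f r)"
  note J = eigenpair_drift_antiderivative[OF assms(1) eig w t, folded j_def]
  have sub: "{a..t} \<subseteq> {a..b}" using t by auto
  have eh: "exp (w y) * h y = ivl_deriv a b f y" for y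
    by (simp add: h_def mult.assoc[symmetric] exp_add[symmetric])
  have eh': "exp (w y) * h' y = - 2 * l * f y" for y
    by (simp add: h'_def exp_minus)
  have "(partition_sum (\<lambda>s u. exp (w s) * h s * (w u - w s)) \<longlongrightarrow>
      exp (w t) * h t - exp (w a) * h a - (integral {a..t} j - integral {a..a} j)) F"
  proof (rule pathwise_ito_exp_mult[OF F _ _ _ qv])
    show "continuous_on {a..t} w" using w sub by (rule continuous_on_subset)
    show "(h has_real_derivative h' x) (at x within {a..t})" if "x \<in> {a..t}" for x
      unfolding h_def h'_def using that sub
      by (intro DERIV_subset[OF eigenpair_derivatives(2)[OF assms(1) eig]]) auto
    show "continuous_on {a..t} h'"
      unfolding h'_def
      by (intro continuous_intros continuous_on_subset[OF w sub]
          continuous_on_subset[OF eigenpair_continuous(1)[OF assms(1) eig w] sub])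
    show "((\<lambda>x. integral {a..x} j) has_real_derivative
        exp (w x) * h' x + 1/2 * (exp (w x) * h x)) (at x within {a..t})" if "x \<in> {a..t}" for x
      using J(3)[OF that] unfolding eh eh' by (simp add: j_def)
  qed
  then show ?thesis
    unfolding eh using J(4) by (simp add: j_def)
qed

lemma convex_step_in_interval:
  fixes t c :: real
  assumes "t \<in> {a..b}" "c \<in> {a..b}"
  shows "t + (c - t) / real (Suc k) \<in> {a..b}"
proof -
  have "t + (c - t) / real (Suc k) = (1 - 1 / real (Suc k)) *\<^sub>R t + (1 / real (Suc k)) *\<^sub>R c"
    by (simp add: diff_divide_distrib algebra_simps del: of_nat_Suc)
  then show ?thesis
    using convexD_alt[OF convex_real_interval(5) assms, of "1 / real (Suc k)"] by simp
qed

text \<open>The points approach \<open>t\<close> from the side of an arbitrary other point \<open>c\<close> of the interval, so the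
  end points need no separate treatment. This expresses a one-sided derivative as a limit of
  random variables.\<close>

lemma difference_quotient_LIMSEQ:
  fixes f :: "real \<Rightarrow> real"
  assumes "(f has_real_derivative D) (at t within {a..b})"
    and t: "t \<in> {a..b}" and c: "c \<in> {a..b}" "c \<noteq> t"
  defines "s \<equiv> \<lambda>k::nat. t + (c - t) / real (Suc k)"
  shows "(\<lambda>k. (f (s k) - f t) / (s k - t)) \<longlonglongrightarrow> D"
proof -
  have s_ivl: "s k \<in> {a..b}" for k
    unfolding s_def by (rule convex_step_in_interval[OF t c(1)])
  have "(\<lambda>k. t + (c - t) * inverse (real (Suc k))) \<longlonglongrightarrow> t + (c - t) * 0"
    by (intro tendsto_intros LIMSEQ_inverse_real_of_nat)
  then have "s \<longlonglongrightarrow> t"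
    by (simp add: s_def divide_inverse)
  then have "filterlim s (at t within {a..b}) sequentially"
    using s_ivl c(2) by (simp add: filterlim_at s_def)
  with assms(1)[unfolded has_field_derivative_iff] show ?thesis
    by (rule filterlim_compose)
qed

theorem proposition10:
  fixes M :: "'w measure"
    and W \<phi> :: "real \<Rightarrow> 'w \<Rightarrow> real"
    and lam :: "'w \<Rightarrow> real"
    and a b :: real
  assumes "a < b"
    and "two_sided_brownian_motion M W"
    and "lam \<in> borel_measurable M"
    and "\<And>t. t \<in> {a..b} \<Longrightarrow> \<phi> t \<in> borel_measurable M"
    and "AE \<omega> in M. eigenpair a b (\<lambda>x. W x \<omega>) (lam \<omega>) (\<lambda>x. \<phi> x \<omega>)"
  shows "solves_sde M W a b lam \<phi> \<and> (AE \<omega> in M. \<phi> a \<omega> = 0 \<and> \<phi> b \<omega> = 0)"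
proof -
  interpret two_sided_brownian_motion M W by fact
  let ?X = "path_deriv a b \<phi>"
  let ?j = "\<lambda>\<omega> r. - 2 * lam \<omega> * \<phi> r \<omega> + 1/2 * ?X r \<omega>"
  let ?J = "\<lambda>t \<omega>. LINT r:{a..t}|lborel. ?j \<omega> r"
  have X: "?X r \<omega> = ivl_deriv a b (\<lambda>x. \<phi> x \<omega>) r" for r \<omega>
    by (simp add: path_deriv_def)
  note [measurable] = assms(3,4) rv

  have "AE \<omega> in M. eigenpair a b (\<lambda>x. W x \<omega>) (lam \<omega>) (\<lambda>x. \<phi> x \<omega>) \<and>
      continuous_on {a..b} (\<lambda>x. W x \<omega>)"
    using assms(5) continuous_paths by eventually_elim (auto intro: continuous_on_subset)
  then obtain N where N: "N \<in> null_sets M"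
    and good: "\<And>\<omega>. \<omega> \<in> space M - N \<Longrightarrow> eigenpair a b (\<lambda>x. W x \<omega>) (lam \<omega>) (\<lambda>x. \<phi> x \<omega>) \<and>
      continuous_on {a..b} (\<lambda>x. W x \<omega>)"
    by (rule AE_E3) blast
  have [measurable]: "N \<in> sets M" using N by auto
  have AE_good: "AE \<omega> in M. \<omega> \<in> space M - N"
    using AE_not_in[OF N] AE_space by eventually_elim simp
  note eig = good[THEN conjunct1] and W_cont = good[THEN conjunct2]
  note drift = eigenpair_drift_antiderivative[OF \<open>a < b\<close> eig W_cont, folded X]

  \<comment> \<open>Setting everything to \<open>0\<close> on \<open>N\<close> turns limits that exist only off \<open>N\<close> into limits at every
    point, so that they are measurable for each time; one null set serves all times.\<close>
  define X' where "X' r \<omega> = (if \<omega> \<in> N then 0 else ?X r \<omega>)" for r \<omega>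
  have X'_meas [measurable]: "X' r \<in> borel_measurable M" if "r \<in> {a..b}" for r
  proof -
    define c where "c = (if r = a then b else a)"
    define s where "s k = r + (c - r) / real (Suc k)" for k
    have c: "c \<in> {a..b}" "c \<noteq> r" using \<open>a < b\<close> by (auto simp: c_def)
    have s: "s k \<in> {a..b}" for k
      unfolding s_def by (rule convex_step_in_interval[OF that c(1)])
    show ?thesis
    proof (rule borel_measurable_LIMSEQ_real)
      fix \<omega> assume "\<omega> \<in> space M"
      then show "(\<lambda>k. if \<omega> \<in> N then 0 else (\<phi> (s k) \<omega> - \<phi> r \<omega>) / (s k - r)) \<longlonglongrightarrow> X' r \<omega>"
        using difference_quotient_LIMSEQ[OF eigenpair_derivatives(1)[OF \<open>a < b\<close> eig that] that c]
        by (auto simp: X'_def X s_def)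
    next
      fix k
      have [measurable]: "\<phi> (s k) \<in> borel_measurable M" "\<phi> r \<in> borel_measurable M"
        using s that assms(4) by auto
      show "(\<lambda>\<omega>. if \<omega> \<in> N then 0 else (\<phi> (s k) \<omega> - \<phi> r \<omega>) / (s k - r)) \<in> borel_measurable M"
        by measurable
    qed
  qed

  \<comment> \<open>The drift integral is measurable as a limit of Riemann sums.\<close>
  define J' where "J' t \<omega> = (if \<omega> \<in> N then 0 else ?J t \<omega>)" for t \<omega>
  have J'_meas: "J' t \<in> borel_measurable M" if t: "t \<in> {a..b}" for t
  proof -
    have "a \<le> t" using t by simp
    then obtain P where P: "\<And>k::nat. is_partition a t (P k)" "\<And>k. mesh_less (1/2^k) (P k)"
      by (rule ex_partition_sequence) blast
    let ?R = "\<lambda>k \<omega>. partition_sum (\<lambda>s u. (- 2 * lam \<omega> * \<phi> s \<omega> + 1/2 * X' s \<omega>) * (u - s)) (P k)"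
    show ?thesis
    proof (rule borel_measurable_LIMSEQ_real)
      fix \<omega> assume \<omega>: "\<omega> \<in> space M"
      show "(\<lambda>k. if \<omega> \<in> N then 0 else ?R k \<omega>) \<longlonglongrightarrow> J' t \<omega>"
      proof (cases "\<omega> \<in> N")
        case False
        with \<omega> have \<omega>': "\<omega> \<in> space M - N" by simp
        note d = drift[OF \<omega>' \<omega>' t]
        have "(\<lambda>k. partition_sum (\<lambda>s u. ?j \<omega> s * (u - s)) (P k)) \<longlonglongrightarrow> ?J t \<omega>"
          unfolding d(4)
          by (rule filterlim_compose[OF riemann_sums_tendsto[OF d(1,3)] filterlim_partition_sequence[OF P]])
        then show ?thesis using False by (simp add: J'_def X'_def)
      qed (simp add: J'_def)
    next
      fix k
      have "?R k \<in> borel_measurable M"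
      proof (rule measurable_partition_sum[OF P(1)])
        fix s u assume "s \<in> {a..t}"
        then have [measurable]: "\<phi> s \<in> borel_measurable M" "X' s \<in> borel_measurable M"
          using t assms(4) X'_meas by auto
        show "(\<lambda>\<omega>. (- 2 * lam \<omega> * \<phi> s \<omega> + 1/2 * X' s \<omega>) * (u - s)) \<in> borel_measurable M"
          by measurable
      qed
      then show "(\<lambda>\<omega>. if \<omega> \<in> N then 0 else ?R k \<omega>) \<in> borel_measurable M"
        by measurable
    qed
  qed

  \<comment> \<open>The stochastic integral is what the equation forces it to be; the work is to show that the
    forward sums converge to it.\<close>
  define I where "I t \<omega> = X' t \<omega> - X' a \<omega> - J' t \<omega>" for t \<omega>
  have forward: "has_forward_integral M W ?X a t (I t)" if t: "t \<in> {a..b}" for t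
    unfolding has_forward_integral_def
  proof
    have [measurable]: "X' t \<in> borel_measurable M" "X' a \<in> borel_measurable M"
      "J' t \<in> borel_measurable M"
      using t \<open>a < b\<close> X'_meas J'_meas by auto
    show I_meas: "I t \<in> borel_measurable M"
      unfolding I_def by measurable
    let ?S' = "\<lambda>P \<omega>. partition_sum (\<lambda>s u. X' s \<omega> * (W u \<omega> - W s \<omega>)) P"
    have S_eq: "forward_sum ?X W P \<omega> = partition_sum (\<lambda>s u. ?X s \<omega> * (W u \<omega> - W s \<omega>)) P" for P \<omega>
      by (cases P) (simp add: forward_sum_def partition_sum_def)
    show "conv_in_prob M (forward_sum ?X W) (I t) (partition_filter a t)"
    proof (rule conv_in_prob_partition_filterI[OF N, where S' = ?S'])
      show "forward_sum ?X W P \<omega> = ?S' P \<omega>" if "\<omega> \<in> space M - N" for P \<omega>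
        using that by (simp add: S_eq X'_def)
      show "?S' P \<in> borel_measurable M" if "is_partition a t P" for P
      proof (rule measurable_partition_sum[OF that])
        fix s u assume "s \<in> {a..t}"
        then have [measurable]: "X' s \<in> borel_measurable M"
          using t X'_meas by auto
        show "(\<lambda>\<omega>. X' s \<omega> * (W u \<omega> - W s \<omega>)) \<in> borel_measurable M"
          by measurable
      qed
      show "I t \<in> borel_measurable M" by (rule I_meas)
      fix P assume P: "\<And>k::nat. is_partition a t (P k)" "\<And>k. mesh_less (1/2^k) (P k)"
      show "AE \<omega> in M. (\<lambda>k. forward_sum ?X W (P k) \<omega>) \<longlonglongrightarrow> I t \<omega>"
        using AE_good AE_monomial_quadratic_variation[OF P]
      proof eventually_elim
        case (elim \<omega>)
        have "(partition_sum (\<lambda>s u. ?X s \<omega> * (W u \<omega> - W s \<omega>)) \<longlongrightarrow> ?X t \<omega> - ?X a \<omega> - ?J t \<omega>)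
            (filtermap P sequentially)"
          unfolding X
        proof (rule eigenpair_pathwise_forward_integral[OF \<open>a < b\<close> eig W_cont t])
          show "filtermap P sequentially \<le> partition_filter a t"
            using filterlim_partition_sequence[OF P] by (simp add: filterlim_def)
          show "(partition_sum (\<lambda>s u. s ^ m * ((W u \<omega> - W s \<omega>)\<^sup>2 - (u - s))) \<longlongrightarrow> 0)
              (filtermap P sequentially)" for m
            using elim(2) by (simp add: filterlim_filtermap)
        qed (use elim in auto)
        then show ?case
          using elim(1) by (simp add: filterlim_filtermap S_eq I_def X'_def J'_def)
      qed
    qed
  qed

  have "AE \<omega> in M. (\<lambda>t. \<phi> t \<omega>) differentiable_on {a..b}"
    using assms(5) by eventually_elim (simp add: eigenpair_def L_dom_def)
  moreover have "AE \<omega> in M. \<forall>t\<in>{a..b}. set_integrable lborel {a..t} (?j \<omega>) \<and>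
      ?X t \<omega> - ?X a \<omega> = ?J t \<omega> + I t \<omega>"
    using AE_good
  proof eventually_elim
    case (elim \<omega>)
    then show ?case
      using drift(2)[OF elim elim] by (simp add: I_def X'_def J'_def)
  qed
  ultimately have "solves_sde M W a b lam \<phi>"
    unfolding solves_sde_def using forward by blast
  moreover have "AE \<omega> in M. \<phi> a \<omega> = 0 \<and> \<phi> b \<omega> = 0"
    using assms(5) by eventually_elim (simp add: eigenpair_def L_dom_def)
  ultimately show ?thesis ..
qed

end
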